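(* Let $\mathbb{F}_2$ be the field with two elements. (a) Let $Q=x^{2m}+\sum_{j=0}^{2m-1}\alpha_j x^j\in\mathbb{F}_2[x]$ be irreducible of even degree $l=2m$. If $\alpha_{2m-1}=1$, then both polynomials $Q(x+x^2)$ and $Q(1+x+x^2)$ are irreducible in $\mathbb{F}_2[x]$ of degree $2l$. If $\alpha_{2m-1}=0$, then each of the polynomials $Q(x+x^2)$ and $Q(1+x+x^2)$ factors in $\mathbb{F}_2[x]$ as a product of two irreducible polynomials of degree $l$ having the same trace. (b) Let $Q=x^{2m+1}+\sum_{j=0}^{2m}\alpha_j x^j\in\mathbb{F}_2[x]$ be irreducible of odd degree $l=2m+1$. Then the polynomial $Q(1+\alpha_{2m}+x+x^2)\in\mathbb{F}_2[x]$ is irreducible of degree $2l$, and the polynomial $Q(\alpha_{2m}+x+x^2)\in\mathbb{F}_2[x]$ factors as a product of two irreducible polynomials of degree $l$ having different traces.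
   Context: For $p$ prime and an irreducible polynomial $F=\sum_{j=0}^d\beta_jx^j\in\mathbb{F}_p[x]$ of degree $d$ dividing $l$, the relative trace is $\mathrm{tr}_l(F)=\sum_{k=0}^{l-1}\rho^{p^k}=-\frac{l}{d}\frac{\beta_{d-1}}{\beta_d}\in\mathbb{F}_p$, where $\rho\in\mathbb{F}_{p^l}$ is a root of $F$. In particular the trace of a monic irreducible polynomial of degree $l$ over $\mathbb{F}_2$ is its coefficient of $x^{l-1}$; "trace" of a degree-$l$ factor above means $\mathrm{tr}_l$ of it. $Q(R)$ denotes the composition $Q\circ R$. *)

theory Defs
  imports
    "HOL-Library.Z2"
    "HOL-Computational_Algebra.Polynomial"
    "HOL-Algebra.Algebraic_Closure_Type"
begin

text \<open>
  The field with two elements is the type \<^typ>\<open>bit\<close>.  The field with \<open>2 ^ l\<close> elements is regarded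
  as a subfield of the algebraic closure \<^typ>\<open>bit alg_closure\<close>: for an irreducible \<open>F\<close> whose degree
  divides \<open>l\<close> it contains every root of \<open>F\<close>.  The power sum below lies in the prime field and does
  not depend on the root; see \<open>rel_trace_root\<close> and \<open>rel_trace_coeff\<close>.
\<close>

definition rel_trace :: "nat \<Rightarrow> bit poly \<Rightarrow> bit" where
  "rel_trace l F =
     (THE t. \<forall>\<rho> :: bit alg_closure. poly (map_poly to_ac F) \<rho> = 0 \<longrightarrow>
        to_ac t = (\<Sum>k<l. \<rho> ^ (2 ^ k)))"

lemma bit_ac_double: "x + x = (0 :: bit alg_closure)"
proof -
  have "x + x = to_ac (1 + 1) * x"
    by (simp only: to_ac_add to_ac_1 distrib_right mult_1_left)
  also have "(1 + 1 :: bit) = 0"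
    by (simp only: one_add_one bit_2_eq_0)
  finally show ?thesis
    by (simp only: to_ac_0 mult_zero_left)
qed

lemma bit_ac_uminus: "- x = (x :: bit alg_closure)"
  by (rule minus_unique) (rule bit_ac_double)

lemma bit_ac_square_add: "(x + y) ^ 2 = x ^ 2 + (y :: bit alg_closure) ^ 2"
proof -
  have "(x + y) ^ 2 = x ^ 2 + y ^ 2 + (x * y + x * y)"
    by (simp add: power2_eq_square algebra_simps)
  thus ?thesis
    by (simp add: bit_ac_double)
qed

lemma bit_ac_square_inj: "x ^ 2 = y ^ 2 \<Longrightarrow> x = (y :: bit alg_closure)"
  by (auto simp: power2_eq_iff bit_ac_uminus)

lemma bit_ac_square_sum: "(\<Sum>x\<in>A. f x) ^ 2 = (\<Sum>x\<in>A. (f x :: bit alg_closure) ^ 2)"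
  by (induction A rule: infinite_finite_induct) (simp_all add: bit_ac_square_add)

lemma map_poly_square_mult:
  "map_poly (\<lambda>x. x ^ 2) (p * q) =
     map_poly (\<lambda>x. x ^ 2) p * map_poly (\<lambda>x. x ^ 2) (q :: bit alg_closure poly)"
  by (rule poly_eqI)
     (simp add: coeff_map_poly coeff_mult bit_ac_square_sum power_mult_distrib)

lemma map_poly_square_prod:
  "map_poly (\<lambda>x. x ^ 2) (\<Prod>k\<in>A. f k) =
     (\<Prod>k\<in>A. map_poly (\<lambda>x. x ^ 2) (f k :: bit alg_closure poly))"
  by (induction A rule: infinite_finite_induct) (simp_all add: map_poly_square_mult)

lemma map_poly_to_ac_add:
  "map_poly to_ac (p + q) = map_poly to_ac p + map_poly to_ac q"
  by (rule poly_eqI) (simp add: coeff_map_poly)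

lemma map_poly_to_ac_mult:
  "map_poly to_ac (p * q) = map_poly to_ac p * map_poly to_ac q"
  by (rule poly_eqI) (simp add: coeff_map_poly coeff_mult to_ac_sum)

lemma bit_power_two: "(c :: bit) ^ 2 = c"
  by (cases c) simp_all

lemma poly_to_ac_square:
  "poly (map_poly to_ac (F :: bit poly)) (x ^ 2) = poly (map_poly to_ac F) x ^ 2"
proof (induction F)
  case (pCons c F)
  have "to_ac c ^ 2 = to_ac c"
    by (simp only: bit_power_two flip: to_ac_power)
  thus ?case using pCons
    by (simp add: map_poly_pCons bit_ac_square_add power_mult_distrib)
qed simp

lemma coeff_prod_linear:
  fixes r :: "nat \<Rightarrow> 'a :: idom"
  shows "degree (\<Prod>k<n. [:- r k, 1:]) = n"
    and "coeff (\<Prod>k<n. [:- r k, 1:]) n = 1"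
    and "n > 0 \<Longrightarrow> coeff (\<Prod>k<n. [:- r k, 1:]) (n - 1) = - (\<Sum>k<n. r k)"
proof -
  show deg: "degree (\<Prod>k<n. [:- r k, 1:]) = n" for n
    by (subst degree_prod_sum_eq) auto
  show lead: "coeff (\<Prod>k<n. [:- r k, 1:]) n = 1" for n
    using lead_coeff_prod[of "\<lambda>k. [:- r k, 1:]" "{..<n}"] by (simp add: deg)
  show "n > 0 \<Longrightarrow> coeff (\<Prod>k<n. [:- r k, 1:]) (n - 1) = - (\<Sum>k<n. r k)"
  proof (induction n)
    case (Suc n)
    show ?case
    proof (cases n)
      case (Suc m)
      thus ?thesis using Suc.IH lead[of n] by (simp add: coeff_pCons mult.commute)
    qed simp
  qed simp
qed

lemma prod_linear_dvd:
  fixes p :: "'a :: idom poly"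
  assumes "finite A" "inj_on r A" "\<And>k. k \<in> A \<Longrightarrow> poly p (r k) = 0"
  shows "(\<Prod>k\<in>A. [:- r k, 1:]) dvd p"
  using assms
proof (induction A arbitrary: p rule: finite_induct)
  case (insert a A)
  obtain q where q: "p = [:- r a, 1:] * q"
    using insert.prems(2)[of a] by (auto simp: poly_eq_0_iff_dvd)
  have "poly q (r k) = 0" if "k \<in> A" for k
  proof -
    have "r k \<noteq> r a"
      using that insert.prems(1) insert.hyps by (auto simp: inj_on_def)
    moreover have "poly p (r k) = 0"
      using that insert.prems(2) by simp
    ultimately show ?thesis by (simp add: q)
  qed
  hence "(\<Prod>k\<in>A. [:- r k, 1:]) dvd q"
    using insert.IH insert.prems(1) by (auto simp: inj_on_def)
  hence "[:- r a, 1:] * (\<Prod>k\<in>A. [:- r k, 1:]) dvd p"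
    unfolding q by (rule mult_dvd_mono[OF dvd_refl])
  thus ?case
    by (simp only: prod.insert[OF insert.hyps])
qed simp

lemma power_two_Suc: "x ^ (2 ^ Suc k) = ((x :: 'a :: monoid_mult) ^ (2 ^ k)) ^ 2"
  by (simp only: power_Suc2 power_mult)

lemma bit_irreducible_split:
  fixes F :: "bit poly" and \<rho> :: "bit alg_closure"
  assumes F: "irreducible F" and \<rho>: "poly (map_poly to_ac F) \<rho> = 0"
  shows "map_poly to_ac F = (\<Prod>k<degree F. [:- (\<rho> ^ (2 ^ k)), 1:])"
    and "\<rho> ^ (2 ^ degree F) = \<rho>"
    and "degree F > 0"
proof -
  define F' where "F' = map_poly to_ac F"
  define r where "r k = \<rho> ^ (2 ^ k)" for k :: nat
  have r0: "r 0 = \<rho>" by (simp add: r_def)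
  have rSuc: "r (Suc k) = r k ^ 2" for k
    by (simp only: r_def power_two_Suc)
  have F0: "F \<noteq> 0" using F by auto
  hence F'0: "F' \<noteq> 0" by (simp add: F'_def map_poly_eq_0_iff)
  have root: "poly F' (r k) = 0" for k
    by (induction k) (use \<rho> in \<open>simp_all add: r0 rSuc F'_def poly_to_ac_square\<close>)
  have "finite (range r)"
    by (rule finite_subset[OF _ poly_roots_finite[OF F'0]]) (use root in auto)
  hence "\<not> inj r" using finite_imageD by blast
  then obtain i j where ij: "i < j" "r i = r j"
    by (metis injI linorder_neqE_nat)
  have cancel: "r i = r j \<Longrightarrow> i \<le> j \<Longrightarrow> r (j - i) = \<rho>" for i j
  proof (induction i arbitrary: j)
    case (Suc i)
    obtain j' where "j = Suc j'" using Suc.prems by (cases j) auto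
    thus ?case using Suc by (auto simp: rSuc dest!: bit_ac_square_inj)
  qed (simp add: r0)
  define e where "e = (LEAST e. e > 0 \<and> r e = \<rho>)"
  have ex: "j - i > 0 \<and> r (j - i) = \<rho>" using ij cancel[of i j] by auto
  have e: "e > 0" "r e = \<rho>"
    using LeastI[of "\<lambda>e. e > 0 \<and> r e = \<rho>", OF ex] by (auto simp: e_def)
  have emin: "e \<le> k" if "k > 0" "r k = \<rho>" for k
    unfolding e_def by (rule Least_le) (use that in auto)
  have no: False if "a < b" "b < e" "r a = r b" for a b
    using cancel[of a b] emin[of "b - a"] that by auto
  have inj: "inj_on r {..<e}"
  proof (rule inj_onI)
    fix a b assume "a \<in> {..<e}" "b \<in> {..<e}" "r a = r b"
    thus "a = b" using no[of a b] no[of b a] by (cases a b rule: linorder_cases) auto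
  qed
  define g where "g = (\<Prod>k<e. [:- r k, 1:])"
  have g_dvd: "g dvd F'"
    unfolding g_def by (rule prod_linear_dvd) (use inj root in auto)
  have "map_poly (\<lambda>x. x ^ 2) g = (\<Prod>k<e. [:- r (Suc k), 1:])"
    unfolding g_def map_poly_square_prod
    by (intro prod.cong refl) (simp add: map_poly_pCons rSuc bit_ac_uminus)
  also have "\<dots> = g"
  proof -
    obtain e' where e': "e = Suc e'" using e(1) by (cases e) auto
    have "(\<Prod>k<e. [:- r (Suc k), 1:]) = (\<Prod>k<e'. [:- r (Suc k), 1:]) * [:- r e, 1:]"
      by (simp add: e' mult.commute)
    also have "\<dots> = [:- r 0, 1:] * (\<Prod>k<e'. [:- r (Suc k), 1:])"
      by (simp only: e(2) r0 mult.commute)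
    also have "\<dots> = g"
      unfolding g_def e' by (simp only: prod.lessThan_Suc_shift)
    finally show ?thesis .
  qed
  finally have frob: "map_poly (\<lambda>x. x ^ 2) g = g" .
  have "coeff g n \<in> range to_ac" for n
  proof -
    have "coeff g n ^ 2 = coeff g n"
      by (subst (2) frob[symmetric]) (simp add: coeff_map_poly)
    hence "coeff g n = to_ac 0 \<or> coeff g n = to_ac 1"
      by (auto simp: power2_eq_square)
    thus ?thesis by blast
  qed
  hence g_eq: "map_poly to_ac (map_poly of_ac g) = g"
    by (intro poly_eqI) (simp add: coeff_map_poly to_ac_of_ac)
  obtain h where gh: "map_poly to_ac h = g"
    using g_eq by blast
  have degh: "degree h = e"
  proof -
    have "degree g = degree h"
      by (simp add: degree_map_poly flip: gh)
    thus ?thesis by (simp add: g_def coeff_prod_linear)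
  qed
  have "F mod h = 0"
  proof (rule ccontr)
    assume nz: "F mod h \<noteq> 0"
    define q where "q = F div h"
    have "F = h * q + F mod h" by (simp add: q_def)
    hence "F' = map_poly to_ac (h * q + F mod h)" by (simp add: F'_def)
    hence "F' = g * map_poly to_ac q + map_poly to_ac (F mod h)"
      by (simp only: map_poly_to_ac_add map_poly_to_ac_mult gh)
    hence "g dvd map_poly to_ac (F mod h)"
      using g_dvd by (metis dvd_add_right_iff dvd_triv_left)
    hence "degree g \<le> degree (map_poly to_ac (F mod h))"
      by (rule dvd_imp_degree_le) (use nz in \<open>simp add: map_poly_eq_0_iff\<close>)
    also have "\<dots> = degree (F mod h)" by (simp add: degree_map_poly)
    also have "\<dots> < degree h"
    proof -
      have "h \<noteq> 0" using degh e(1) by auto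
      thus ?thesis using degree_mod_less[of h F] nz by blast
    qed
    also have "\<dots> = degree g" by (simp add: degh g_def coeff_prod_linear)
    finally show False by simp
  qed
  then obtain q where q: "F = h * q" by (auto simp: mod_eq_0_iff_dvd)
  have "\<not> h dvd 1" using degh e(1) by (auto simp: is_unit_poly_iff)
  hence "q dvd 1" using irreducibleD[OF F q] by auto
  then obtain c where "q = [:c:]" "c \<noteq> 0" by (auto simp: is_unit_poly_iff)
  hence "q = 1" by (cases c) (simp_all add: one_pCons)
  hence Fh: "F = h" by (simp add: q)
  show "map_poly to_ac F = (\<Prod>k<degree F. [:- (\<rho> ^ (2 ^ k)), 1:])"
    unfolding Fh degh gh by (simp only: g_def r_def)
  show "\<rho> ^ (2 ^ degree F) = \<rho>" using e by (simp add: Fh degh r_def)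
  show "degree F > 0" using e by (simp add: Fh degh)
qed

lemma bit_power_sum_root:
  fixes F :: "bit poly" and \<rho> :: "bit alg_closure"
  assumes F: "irreducible F" and dvd: "degree F dvd l" and \<rho>: "poly (map_poly to_ac F) \<rho> = 0"
  shows "(\<Sum>k<l. \<rho> ^ (2 ^ k)) =
           to_ac (- of_nat (l div degree F) * (coeff F (degree F - 1) / coeff F (degree F)))"
proof -
  define d where "d = degree F"
  define r where "r k = \<rho> ^ (2 ^ k)" for k :: nat
  have split: "map_poly to_ac F = (\<Prod>k<d. [:- r k, 1:])" and rd: "r d = \<rho>" and d: "d > 0"
    using bit_irreducible_split[OF F \<rho>] by (auto simp: r_def d_def)
  have rSuc: "r (Suc k) = r k ^ 2" for k by (simp only: r_def power_two_Suc)
  have per: "r (k + d) = r k" for k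
    by (induction k) (simp_all add: rSuc rd, simp add: r_def)
  have per': "r (m * d + k) = r k" for m k
  proof (induction m)
    case (Suc m)
    have "r (Suc m * d + k) = r ((m * d + k) + d)" by (simp add: algebra_simps)
    thus ?case using Suc by (simp only: per)
  qed simp
  have lead: "coeff F d = 1"
    using F by (cases "coeff F d") (auto simp: d_def)
  have c: "(\<Sum>k<d. r k) = - to_ac (coeff F (d - 1))"
    using arg_cong[OF split, of "\<lambda>p. coeff p (d - 1)"] coeff_prod_linear(3)[OF d, of r]
    by (simp add: coeff_map_poly)
  have "(\<Sum>k<m * d. r k) = of_nat m * (\<Sum>k<d. r k)" for m
  proof (induction m)
    case (Suc m)
    have "(\<Sum>k<Suc m * d. r k) = (\<Sum>k<m * d + d. r k)"
      by (simp add: algebra_simps)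
    also have "\<dots> = (\<Sum>k<m * d. r k) + (\<Sum>k<d. r (m * d + k))"
      using sum.atLeastLessThan_concat[of 0 "m * d" "m * d + d" r]
        sum.shift_bounds_nat_ivl[of r 0 "m * d" d]
      by (simp add: lessThan_atLeast0 add.commute)
    also have "\<dots> = of_nat (Suc m) * (\<Sum>k<d. r k)"
      unfolding Suc per' by (simp add: algebra_simps)
    finally show ?case .
  qed simp
  from this[of "l div d"] have "(\<Sum>k<l. r k) = of_nat (l div d) * (\<Sum>k<d. r k)"
    using dvd by (simp add: d_def)
  also have "\<dots> = to_ac (- of_nat (l div d) * (coeff F (d - 1) / coeff F d))"
    by (simp only: c lead to_ac_mult to_ac_minus to_ac_of_nat div_by_1
        mult_minus_left mult_minus_right)
  finally show ?thesis
    by (simp only: r_def d_def)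
qed

lemma rel_trace_coeff:
  assumes "irreducible F" "degree F dvd l"
  shows "rel_trace l F =
           - of_nat (l div degree F) * (coeff F (degree F - 1) / coeff F (degree F))"
proof -
  have "degree F > 0"
  proof (rule ccontr)
    assume "\<not> degree F > 0"
    then obtain c where c: "F = [:c:]" by (auto elim: degree_eq_zeroE)
    thus False using assms(1) by (cases c) (simp_all add: flip: one_pCons)
  qed
  hence "degree (map_poly to_ac F) > 0" by (simp add: degree_map_poly)
  then obtain \<rho> :: "bit alg_closure" where \<rho>: "poly (map_poly to_ac F) \<rho> = 0"
    using alg_closed_imp_poly_has_root by blast
  show ?thesis
    unfolding rel_trace_def
  proof (rule the_equality)
    fix t
    assume "\<forall>\<rho> :: bit alg_closure. poly (map_poly to_ac F) \<rho> = 0 \<longrightarrow>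
              to_ac t = (\<Sum>k<l. \<rho> ^ (2 ^ k))"
    hence "to_ac t = (\<Sum>k<l. \<rho> ^ (2 ^ k))" using \<rho> by blast
    thus "t = - of_nat (l div degree F) * (coeff F (degree F - 1) / coeff F (degree F))"
      by (simp only: bit_power_sum_root[OF assms \<rho>] to_ac_eq_iff)
  qed (metis bit_power_sum_root[OF assms])
qed

lemma rel_trace_root:
  assumes "irreducible F" "degree F dvd l" "poly (map_poly to_ac F) \<rho> = 0"
  shows "to_ac (rel_trace l F) = (\<Sum>k<l. \<rho> ^ (2 ^ k))"
  using bit_power_sum_root[OF assms] rel_trace_coeff[OF assms(1,2)] by simp

end

theory Submission
  imports Defs
begin

text \<open>
  Let \<open>\<rho>\<close> be a root of \<open>Q(c + x + x\<^sup>2)\<close>, where \<open>Q\<close> is irreducible of degree \<open>l\<close>, and let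
  \<open>\<sigma> = c + \<rho> + \<rho>\<^sup>2\<close> be the corresponding root of \<open>Q\<close>.  Telescoping \<open>\<rho> + \<rho>\<^sup>2 = \<sigma> + c\<close> along the
  Frobenius gives \<open>\<rho> ^ (2 ^ l) = \<rho> + t\<close> with \<open>t = tr(\<sigma>) + l c\<close> in the prime field.  The degree of
  \<open>\<rho>\<close> is a multiple of \<open>l\<close> and at most \<open>2 l\<close>, so it is \<open>2 l\<close> if \<open>t = 1\<close> and \<open>l\<close> if \<open>t = 0\<close>.  In the
  second case the two factors of degree \<open>l\<close> have traces summing to the coefficient of
  \<open>x ^ (2 l - 1)\<close> in \<open>Q(c + x + x\<^sup>2)\<close>, which is \<open>l\<close> modulo 2.
\<close>

section \<open>Minimal polynomials of elements of the algebraic closure\<close>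

lemma minimal_poly_exists:
  fixes p :: "'a :: field poly" and x :: "'a alg_closure"
  assumes "p \<noteq> 0" "poly (map_poly to_ac p) x = 0"
  obtains F where "irreducible F" "poly (map_poly to_ac F) x = 0"
    "\<And>q. poly (map_poly to_ac q) x = 0 \<Longrightarrow> F dvd q"
proof -
  define S where "S = (\<lambda>q :: 'a poly. q \<noteq> 0 \<and> poly (map_poly to_ac q) x = 0)"
  have "S p" using assms by (simp add: S_def)
  \<comment> \<open>The witness is an annihilating polynomial of least degree. A nonzero remainder
    modulo it would be a smaller one, and the resulting divisibility of all annihilators gives
    irreducibility.\<close>
  then obtain F where F: "S F" "\<And>q. S q \<Longrightarrow> degree F \<le> degree q"
    using ex_has_least_nat[of S p degree] by blast
  have F0: "F \<noteq> 0" and root: "poly (map_poly to_ac F) x = 0"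
    using F(1) by (auto simp: S_def)
  have min: "F dvd q" if q: "poly (map_poly to_ac q) x = 0" for q
  proof -
    have "poly (map_poly to_ac (F * (q div F) + q mod F)) x = 0"
      using q by simp
    hence "poly (map_poly to_ac (q mod F)) x = 0"
      by (simp only: map_poly_to_ac_add map_poly_to_ac_mult poly_add poly_mult root) simp
    hence "q mod F = 0"
      using F(2)[of "q mod F"] degree_mod_less[OF F0, of q] by (force simp: S_def)
    thus ?thesis by (simp add: mod_eq_0_iff_dvd)
  qed
  have "irreducible F"
  proof (rule irreducibleI)
    show "\<not> is_unit F"
    proof
      assume "is_unit F"
      then obtain c where "F = [:c:]" by (auto simp: is_unit_poly_iff)
      thus False using root F0 by (simp add: map_poly_pCons)
    qed
    fix a b assume ab: "F = a * b"
    hence "poly (map_poly to_ac a) x = 0 \<or> poly (map_poly to_ac b) x = 0"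
      using root by (simp add: map_poly_to_ac_mult)
    hence "F dvd a \<or> F dvd b" using min by blast
    thus "is_unit a \<or> is_unit b"
    proof
      assume "F dvd a"
      hence "a * b dvd a * 1" by (simp add: ab)
      thus ?thesis using F0 ab by (metis dvd_mult_cancel_left mult_zero_left)
    next
      assume "F dvd b"
      hence "a * b dvd 1 * b" by (simp add: ab)
      thus ?thesis using F0 ab by (metis dvd_mult_cancel_right mult_zero_right)
    qed
  qed (rule F0)
  thus thesis using root min that by blast
qed

text \<open>The minimal polynomial \<open>G\<close> of \<open>x\<close> divides \<open>F\<close>;
  irreducibility makes the two associates, so \<open>F\<close> inherits from \<open>G\<close> that
  it divides every polynomial vanishing at \<open>x\<close>.\<close>

lemma irreducible_dvd_of_common_root:
  fixes F p :: "'a :: field poly"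
  assumes "irreducible F" "poly (map_poly to_ac F) x = 0" "poly (map_poly to_ac p) x = 0"
  shows "F dvd p"
proof -
  have "F \<noteq> 0" using assms(1) by auto
  then obtain G where G: "irreducible G" "\<And>q. poly (map_poly to_ac q) x = 0 \<Longrightarrow> G dvd q"
    using assms(2) minimal_poly_exists by blast
  obtain q where q: "F = G * q" using G(2)[OF assms(2)] by (auto elim: dvdE)
  hence "is_unit q" using irreducibleD[OF assms(1) q] G(1) irreducible_not_unit by blast
  hence "F dvd G" by (simp add: q mult_unit_dvd_iff)
  thus ?thesis using G(2)[OF assms(3)] dvd_trans by blast
qed

lemma irreducible_of_dvd_same_degree:
  fixes F p :: "'a :: field poly"
  assumes "irreducible F" "F dvd p" "p \<noteq> 0" "degree p = degree F"
  shows "irreducible p"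
proof -
  obtain q where q: "p = F * q" using assms(2) by (auto elim: dvdE)
  have nz: "F \<noteq> 0" "q \<noteq> 0" using assms(3) q by auto
  hence "degree q = 0" using assms(4) by (simp add: q degree_mult_eq)
  hence "is_unit q" using nz is_unit_iff_degree by blast
  thus ?thesis unfolding q using assms(1) by (metis irreducible_mult_unit_left mult.commute)
qed

section \<open>Frobenius orbits and degrees over the prime field\<close>

lemma bit_ac_frobenius_add:
  "(x + y) ^ (2 ^ k) = x ^ (2 ^ k) + (y :: bit alg_closure) ^ (2 ^ k)"
proof (induction k)
  case (Suc k)
  show ?case by (simp only: power_two_Suc Suc bit_ac_square_add)
qed simp

lemma to_ac_bit_power_two_power: "to_ac (c :: bit) ^ (2 ^ k) = to_ac c"
  by (cases c) (simp_all add: power_0_left)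

text \<open>Each summand is \<open>x ^ (2 ^ Suc k) + x ^ (2 ^ k)\<close>, and the inner terms cancel
  in pairs in characteristic 2.\<close>

lemma bit_ac_telescope:
  fixes x :: "bit alg_closure"
  shows "(\<Sum>k<n. (x ^ 2 + x) ^ (2 ^ k)) = x ^ (2 ^ n) + x"
proof (induction n)
  case (Suc n)
  have "(x ^ 2 + x) ^ (2 ^ n) = x ^ (2 ^ Suc n) + x ^ (2 ^ n)"
    by (simp add: bit_ac_frobenius_add flip: power_mult)
  hence "(\<Sum>k<Suc n. (x ^ 2 + x) ^ (2 ^ k)) =
           x ^ (2 ^ Suc n) + x + (x ^ (2 ^ n) + x ^ (2 ^ n))"
    using Suc by (simp add: algebra_simps)
  thus ?case by (simp add: bit_ac_double)
qed (simp add: bit_ac_double)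

text \<open>A coefficient fixed by squaring is a root of \<open>y ^ 2 = y\<close>, hence 0 or
  1.\<close>

lemma frobenius_invariant_poly_descends:
  fixes g :: "bit alg_closure poly"
  assumes "map_poly (\<lambda>x. x ^ 2) g = g"
  obtains h :: "bit poly" where "map_poly to_ac h = g"
proof -
  have "coeff g n \<in> range to_ac" for n
  proof -
    have "coeff g n ^ 2 = coeff g n"
      by (subst (2) assms[symmetric]) (simp add: coeff_map_poly)
    hence "coeff g n = to_ac 0 \<or> coeff g n = to_ac 1"
      by (auto simp: power2_eq_square)
    thus ?thesis by blast
  qed
  hence "map_poly to_ac (map_poly of_ac g) = g"
    by (intro poly_eqI) (simp add: coeff_map_poly to_ac_of_ac)
  thus thesis by (rule that)
qed

text \<open>Frobenius permutes the linear factors of \<open>g\<close>, so \<open>g\<close> comes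
  from a polynomial of degree \<open>d\<close> over \<open>bit\<close> that vanishes at
  \<open>x\<close> and is therefore divisible by \<open>F\<close>. Repeated factors do no harm, as
  only the degree and the root matter.\<close>

lemma bit_irreducible_degree_le:
  fixes F :: "bit poly" and x :: "bit alg_closure"
  assumes F: "irreducible F" "poly (map_poly to_ac F) x = 0"
    and d: "d > 0" "x ^ (2 ^ d) = x"
  shows "degree F \<le> d"
proof -
  define r where "r k = x ^ (2 ^ k)" for k :: nat
  define g where "g = (\<Prod>k<d. [:- r k, 1:])"
  obtain d' where d': "d = Suc d'" using d(1) by (cases d) auto
  have "map_poly (\<lambda>x. x ^ 2) g = (\<Prod>k<d. [:- r (Suc k), 1:])"
    unfolding g_def map_poly_square_prod
    by (intro prod.cong refl)
       (simp add: map_poly_pCons r_def bit_ac_uminus mult.commute flip: power_mult)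
  also have "\<dots> = (\<Prod>k<d'. [:- r (Suc k), 1:]) * [:- r d, 1:]"
    by (simp add: d' mult.commute)
  \<comment> \<open>The shifted product wraps around: \<open>r d = r 0\<close> is the hypothesis on
    \<open>d\<close>.\<close>
  also have "\<dots> = [:- r 0, 1:] * (\<Prod>k<d'. [:- r (Suc k), 1:])"
    using d(2) by (simp add: r_def mult.commute)
  also have "\<dots> = g"
    unfolding g_def d' by (simp only: prod.lessThan_Suc_shift)
  finally obtain h :: "bit poly" where h: "map_poly to_ac h = g"
    by (rule frobenius_invariant_poly_descends)
  have degh: "degree h = d"
    using coeff_prod_linear(1)[of r d] by (simp add: degree_map_poly flip: g_def h)
  have "poly g x = 0"
    unfolding g_def d' by (simp add: prod.lessThan_Suc_shift r_def del: prod.lessThan_Suc)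
  hence "F dvd h" using irreducible_dvd_of_common_root[OF F] h by simp
  thus ?thesis using dvd_imp_degree_le[of F h] degh d(1) by (cases "h = 0") auto
qed

lemma bit_irreducible_degree_dvd:
  fixes F :: "bit poly" and x :: "bit alg_closure"
  assumes F: "irreducible F" "poly (map_poly to_ac F) x = 0" and d: "x ^ (2 ^ d) = x"
  shows "degree F dvd d"
proof -
  define l where "l = degree F"
  have l: "l > 0" "x ^ (2 ^ l) = x"
    using bit_irreducible_split[OF F] by (auto simp: l_def)
  have per: "x ^ (2 ^ (l * n)) = x" for n
  proof (induction n)
    case (Suc n)
    have "x ^ (2 ^ (l * Suc n)) = (x ^ (2 ^ (l * n))) ^ (2 ^ l)"
      by (simp add: power_add mult.commute flip: power_mult)
    thus ?case using Suc l by simp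
  qed simp
  have "x = x ^ (2 ^ (l * (d div l) + d mod l))" using d by simp
  also have "\<dots> = (x ^ (2 ^ (l * (d div l)))) ^ (2 ^ (d mod l))"
    by (simp only: power_add power_mult)
  finally have "x ^ (2 ^ (d mod l)) = x" by (simp only: per)
  \<comment> \<open>A positive remainder would be a Frobenius period of \<open>x\<close> smaller
    than the degree \<open>l\<close>.\<close>
  hence "d mod l = 0"
    using bit_irreducible_degree_le[OF F, of "d mod l"] l(1)
    by (metis l_def mod_less_divisor not_le neq0_conv)
  thus ?thesis by (simp add: l_def mod_eq_0_iff_dvd)
qed

section \<open>Composition with a quadratic and the Frobenius image of its roots\<close>

lemma coeff_pcompose_monic_quadratic:
  fixes Q :: "'a :: idom poly"
  assumes "degree Q > 0"
  shows "coeff (Q \<circ>\<^sub>p [:c, b, 1:]) (2 * degree Q - 1) = of_nat (degree Q) * b * lead_coeff Q"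
  using assms
proof (induction Q)
  case (pCons a Q)
  define S where "S = Q \<circ>\<^sub>p [:c, b, 1:]"
  define n where "n = degree Q"
  have Q0: "Q \<noteq> 0" using pCons.prems by auto
  have degS: "degree S = 2 * n" by (simp add: S_def n_def degree_pcompose)
  have leadS: "coeff S (2 * n) = lead_coeff Q"
    using lead_coeff_comp[of "[:c, b, 1:]" Q] degS by (simp add: S_def)
  have S1: "coeff S (Suc (2 * n)) = 0" using degS by (simp add: coeff_eq_0)
  \<comment> \<open>The composition is \<open>[:a:] + [:c, b, 1:] * S\<close>. The case distinction
    is needed because for \<open>n = 0\<close> the truncated index \<open>2 * n - 1\<close> would
    pick the constant coefficient of \<open>S\<close>, whereas the square term contributes nothing
    there.\<close>
  have "coeff (pCons a Q \<circ>\<^sub>p [:c, b, 1:]) (Suc (2 * n)) =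
          b * coeff S (2 * n) + (case n of 0 \<Rightarrow> 0 | Suc k \<Rightarrow> coeff S (2 * n - 1))"
    by (simp add: pcompose_pCons S1 coeff_pCons flip: S_def split: nat.splits)
  also have "\<dots> = of_nat (Suc n) * b * lead_coeff Q"
  proof (cases n)
    case (Suc k)
    have "coeff S (2 * n - 1) = of_nat n * b * lead_coeff Q"
      using pCons.IH Suc by (simp add: S_def n_def)
    thus ?thesis unfolding leadS using Suc by (simp add: algebra_simps)
  qed (use leadS in simp)
  finally show ?case using Q0 by (simp add: n_def)
qed simp

lemma bit_lead_coeff: "F \<noteq> 0 \<Longrightarrow> lead_coeff (F :: bit poly) = 1"
  by (cases "lead_coeff F") simp_all

lemma map_poly_to_ac_pcompose:
  "map_poly to_ac (p \<circ>\<^sub>p q) = map_poly to_ac p \<circ>\<^sub>p map_poly to_ac q"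
  by (induction p)
     (simp_all add: pcompose_pCons map_poly_pCons map_poly_to_ac_add map_poly_to_ac_mult)

lemma frobenius_root_artin_schreier_compose:
  fixes Q :: "bit poly" and \<rho> :: "bit alg_closure"
  assumes Q: "irreducible Q" and \<rho>: "poly (map_poly to_ac (Q \<circ>\<^sub>p [:c, 1, 1:])) \<rho> = 0"
  shows "poly (map_poly to_ac Q) (\<rho> ^ 2 + \<rho> + to_ac c) = 0"
    and "\<rho> ^ (2 ^ degree Q) = \<rho> + to_ac (coeff Q (degree Q - 1) + of_nat (degree Q) * c)"
proof -
  define l where "l = degree Q"
  define \<sigma> where "\<sigma> = \<rho> ^ 2 + \<rho> + to_ac c"
  have "poly (map_poly to_ac [:c, 1, 1:]) \<rho> = \<sigma>"
    by (simp add: map_poly_pCons \<sigma>_def power2_eq_square algebra_simps)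
  thus root: "poly (map_poly to_ac Q) (\<rho> ^ 2 + \<rho> + to_ac c) = 0"
    using \<rho> by (simp add: map_poly_to_ac_pcompose poly_pcompose \<sigma>_def)
  have l: "l > 0" using bit_irreducible_split(3)[OF Q root] by (simp add: l_def)
  have "lead_coeff Q = 1" using Q by (intro bit_lead_coeff) auto
  \<comment> \<open>Since \<open>Q\<close> is monic and signs vanish over \<open>bit\<close>, the
    power sum is just the second coefficient of \<open>Q\<close>.\<close>
  hence tr: "(\<Sum>k<l. \<sigma> ^ (2 ^ k)) = to_ac (coeff Q (l - 1))"
    using bit_power_sum_root[OF Q dvd_refl root] l by (simp add: l_def \<sigma>_def)
  have "\<rho> ^ 2 + \<rho> = \<sigma> + to_ac c"
    using bit_ac_double[of "to_ac c"] by (simp add: \<sigma>_def add.assoc)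
  hence "\<rho> ^ (2 ^ l) + \<rho> = (\<Sum>k<l. (\<sigma> + to_ac c) ^ (2 ^ k))"
    using bit_ac_telescope[of \<rho> l] by simp
  \<comment> \<open>The constant \<open>c\<close> is fixed by Frobenius, so it is added
    \<open>l\<close> times.\<close>
  also have "\<dots> = to_ac (coeff Q (l - 1) + of_nat l * c)"
    by (simp only: bit_ac_frobenius_add sum.distrib tr to_ac_bit_power_two_power to_ac_add
        to_ac_mult to_ac_of_nat sum_constant card_lessThan)
  finally have "\<rho> ^ (2 ^ l) + (\<rho> + \<rho>) = \<rho> + to_ac (coeff Q (l - 1) + of_nat l * c)"
    by (simp only: add.assoc add.commute add.left_commute)
  thus "\<rho> ^ (2 ^ degree Q) = \<rho> + to_ac (coeff Q (degree Q - 1) + of_nat (degree Q) * c)"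
    by (simp only: bit_ac_double l_def add_0_right)
qed

section \<open>Irreducibility or splitting of the composition\<close>

lemma bit_poly_has_root:
  fixes P :: "bit poly"
  assumes "degree P > 0"
  obtains \<rho> :: "bit alg_closure" where "poly (map_poly to_ac P) \<rho> = 0"
proof -
  have "degree (map_poly to_ac P) > 0" using assms by (simp add: degree_map_poly)
  thus thesis using alg_closed_imp_poly_has_root that by blast
qed

lemma bit_irreducible_degree_pos:
  fixes F :: "bit poly"
  assumes "irreducible F"
  shows "degree F > 0"
proof -
  have "F \<noteq> 0" "\<not> is_unit F" using assms irreducible_not_unit by auto
  thus ?thesis using is_unit_iff_degree by blast
qed

text \<open>Only the index pairs \<open>(k, Suc k)\<close> and \<open>(Suc k, k)\<close> stay within
  both degrees. For monic factors this coefficient is the sum of their traces.\<close>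

lemma coeff_mult_second_leading:
  fixes F G :: "'a :: comm_semiring_1 poly"
  assumes "degree F = Suc k" "degree G = Suc k"
  shows "coeff (F * G) (Suc (2 * k)) =
           coeff F (Suc k) * coeff G k + coeff F k * coeff G (Suc k)"
proof -
  have "coeff (F * G) (Suc (2 * k)) = (\<Sum>i\<le>Suc (2 * k). coeff F i * coeff G (Suc (2 * k) - i))"
    by (rule coeff_mult)
  also have "\<dots> = (\<Sum>i\<in>{k, Suc k}. coeff F i * coeff G (Suc (2 * k) - i))"
  proof (rule sum.mono_neutral_right)
    show "\<forall>i\<in>{..Suc (2 * k)} - {k, Suc k}. coeff F i * coeff G (Suc (2 * k) - i) = 0"
    proof
      fix i assume "i \<in> {..Suc (2 * k)} - {k, Suc k}"
      hence "i > degree F \<or> Suc (2 * k) - i > degree G" using assms by auto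
      thus "coeff F i * coeff G (Suc (2 * k) - i) = 0" by (auto simp: coeff_eq_0)
    qed
  qed auto
  also have "\<dots> = coeff F (Suc k) * coeff G k + coeff F k * coeff G (Suc k)"
    by (simp add: Suc_diff_le add.commute)
  finally show ?thesis .
qed

lemma degree_factor_artin_schreier_compose:
  fixes Q F :: "bit poly" and \<rho> :: "bit alg_closure"
  assumes Q: "irreducible Q" and F: "irreducible F" "poly (map_poly to_ac F) \<rho> = 0"
    and \<rho>: "poly (map_poly to_ac (Q \<circ>\<^sub>p [:c, 1, 1:])) \<rho> = 0"
  shows "degree F = (if coeff Q (degree Q - 1) + of_nat (degree Q) * c = 0
                     then degree Q else 2 * degree Q)"
proof -
  define l where "l = degree Q"
  define t where "t = coeff Q (l - 1) + of_nat l * c"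
  define \<sigma> where "\<sigma> = \<rho> ^ 2 + \<rho> + to_ac c"
  have root: "poly (map_poly to_ac Q) \<sigma> = 0"
    and frob: "\<rho> ^ (2 ^ l) = \<rho> + to_ac t"
    using frobenius_root_artin_schreier_compose[OF Q \<rho>] by (simp_all add: \<sigma>_def l_def t_def)
  have l: "l > 0" using bit_irreducible_split(3)[OF Q root] by (simp add: l_def)
  have P0: "Q \<circ>\<^sub>p [:c, 1, 1:] \<noteq> 0"
    using l degree_pcompose[of Q "[:c, 1, 1:]"] by (auto simp: l_def)
  have F': "\<rho> ^ (2 ^ degree F) = \<rho>" "degree F > 0"
    using bit_irreducible_split[OF F] by auto
  \<comment> \<open>Since \<sigma> is a polynomial in \<rho> over the prime field, every Frobenius
    period of \<rho> is one of \<sigma>; this makes \<open>l\<close> divide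
    \<open>degree F\<close>.\<close>
  have "\<sigma> ^ (2 ^ degree F) = (\<rho> ^ (2 ^ degree F)) ^ 2 + \<rho> ^ (2 ^ degree F) + to_ac c"
    by (simp add: \<sigma>_def bit_ac_frobenius_add to_ac_bit_power_two_power mult.commute
        flip: power_mult)
  hence "\<sigma> ^ (2 ^ degree F) = \<sigma>" by (simp only: F' \<sigma>_def)
  hence ldvd: "l dvd degree F"
    using bit_irreducible_degree_dvd[OF Q root] by (simp add: l_def)
  show ?thesis
  proof (cases "t = 0")
    case True
    hence "degree F dvd l" using bit_irreducible_degree_dvd[OF F, of l] frob by simp
    thus ?thesis using ldvd True by (simp add: dvd_antisym t_def l_def)
  next
    case False
    have "degree F \<le> 2 * l"
      using dvd_imp_degree_le[OF irreducible_dvd_of_common_root[OF F \<rho>] P0]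
      by (simp add: l_def degree_pcompose)
    \<comment> \<open>Degree \<open>l\<close> would force \<open>\<rho> ^ (2 ^ l) = \<rho>\<close>,
      but this power is \<open>\<rho> + to_ac t\<close> with \<open>t\<close> nonzero.\<close>
    moreover have "degree F \<noteq> l"
      using F'(1) frob False by auto
    moreover obtain k where k: "degree F = l * k" using ldvd by (auto elim: dvdE)
    ultimately have "k \<le> 2" "k \<noteq> 0" "k \<noteq> 1" using l F'(2) by auto
    hence "k = 2" by simp
    thus ?thesis using k False by (simp add: t_def l_def)
  qed
qed

lemma artin_schreier_compose_irreducible:
  fixes Q :: "bit poly"
  assumes Q: "irreducible Q" and t: "coeff Q (degree Q - 1) + of_nat (degree Q) * c = 1"
  shows "irreducible (Q \<circ>\<^sub>p [:c, 1, 1:])"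
proof -
  define P where "P = Q \<circ>\<^sub>p [:c, 1, 1:]"
  have "degree Q > 0" using bit_irreducible_degree_pos[OF Q] .
  hence P: "degree P = 2 * degree Q" "degree P > 0" by (simp_all add: P_def degree_pcompose)
  obtain \<rho> :: "bit alg_closure" where \<rho>: "poly (map_poly to_ac P) \<rho> = 0"
    using bit_poly_has_root P(2) by blast
  have P0: "P \<noteq> 0" using P(2) by auto
  obtain F where F: "irreducible F" "poly (map_poly to_ac F) \<rho> = 0"
    using minimal_poly_exists[OF P0 \<rho>] by metis
  have "degree F = degree P"
    using degree_factor_artin_schreier_compose[OF Q F \<rho>[unfolded P_def]] P(1) unfolding t by simp
  thus ?thesis
    using irreducible_of_dvd_same_degree[OF F(1) irreducible_dvd_of_common_root[OF F \<rho>] P0]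
    by (simp add: P_def)
qed

lemma artin_schreier_compose_splits:
  fixes Q :: "bit poly"
  assumes Q: "irreducible Q" and t: "coeff Q (degree Q - 1) + of_nat (degree Q) * c = 0"
  obtains F G where "Q \<circ>\<^sub>p [:c, 1, 1:] = F * G" "irreducible F" "irreducible G"
    "degree F = degree Q" "degree G = degree Q"
    "rel_trace (degree Q) F + rel_trace (degree Q) G = of_nat (degree Q)"
proof -
  define P where "P = Q \<circ>\<^sub>p [:c, 1, 1:]"
  define l where "l = degree Q"
  have l: "l > 0" using bit_irreducible_degree_pos[OF Q] by (simp add: l_def)
  hence P: "degree P = 2 * l" "degree P > 0" by (simp_all add: P_def l_def degree_pcompose)
  have P0: "P \<noteq> 0" using P(2) by auto
  have deg: "degree F = l"
    if "irreducible F" "poly (map_poly to_ac F) \<rho> = 0" "poly (map_poly to_ac P) \<rho> = 0" for F \<rho>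
    using degree_factor_artin_schreier_compose[OF Q that(1,2) that(3)[unfolded P_def]] t
    by (simp add: l_def)
  obtain \<rho> :: "bit alg_closure" where \<rho>: "poly (map_poly to_ac P) \<rho> = 0"
    using bit_poly_has_root P(2) by blast
  obtain F where F: "irreducible F" "poly (map_poly to_ac F) \<rho> = 0"
    using minimal_poly_exists[OF P0 \<rho>] by metis
  obtain G where G: "P = F * G"
    using irreducible_dvd_of_common_root[OF F \<rho>] by (auto elim: dvdE)
  have nz: "F \<noteq> 0" "G \<noteq> 0" using P0 G by auto
  have dF: "degree F = l" using deg[OF F \<rho>] .
  hence dG: "degree G = l" using P(1) nz by (simp add: G degree_mult_eq)
  obtain \<tau> :: "bit alg_closure" where \<tau>: "poly (map_poly to_ac G) \<tau> = 0"
    using bit_poly_has_root[of G] dG l by blast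
  obtain H where H: "irreducible H" "poly (map_poly to_ac H) \<tau> = 0"
    using minimal_poly_exists[OF nz(2) \<tau>] by metis
  \<comment> \<open>A root of the cofactor \<open>G\<close> is also a root of \<open>P\<close>, so
    its minimal polynomial has degree \<open>l\<close> as well and exhausts
    \<open>G\<close>.\<close>
  have "degree H = l" using deg[OF H] \<tau> by (simp add: G map_poly_to_ac_mult)
  hence irrG: "irreducible G"
    using irreducible_of_dvd_same_degree[OF H(1) irreducible_dvd_of_common_root[OF H \<tau>] nz(2)] dG
    by simp
  have lead: "coeff F l = 1" "coeff G l = 1"
    using bit_lead_coeff nz dF dG by metis+
  have tr: "rel_trace l F = coeff F (l - 1)" "rel_trace l G = coeff G (l - 1)"
    using rel_trace_coeff[OF F(1), of l] rel_trace_coeff[OF irrG, of l] dF dG lead l by simp_all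
  obtain k where k: "l = Suc k" using l by (cases l) auto
  \<comment> \<open>The coefficient at \<open>2 * l - 1\<close> is computed twice: from the factors
    it is the sum of traces, from the composition it is \<open>l\<close>.\<close>
  have "coeff (F * G) (2 * l - 1) = coeff F l * coeff G (l - 1) + coeff F (l - 1) * coeff G l"
    using coeff_mult_second_leading[of F k G] dF dG by (simp add: k)
  moreover have "coeff P (2 * l - 1) = of_nat l"
    using coeff_pcompose_monic_quadratic[of Q c 1] l bit_lead_coeff[of Q] Q
    by (auto simp: P_def l_def)
  ultimately have "rel_trace l F + rel_trace l G = of_nat l"
    by (simp only: G tr lead add.commute mult_1_left mult_1_right)
  thus thesis using that G F(1) irrG dF dG by (simp add: P_def l_def)
qed

section \<open>The explicit monic polynomial and the two parities of its degree\<close>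

lemma coeff_monic_sum:
  "coeff (monom (1 :: 'a :: comm_semiring_1) n + (\<Sum>j<n. monom (\<alpha> j) j)) i =
     (if i = n then 1 else if i < n then \<alpha> i else 0)"
  by (simp add: coeff_sum)

lemma degree_monic_sum:
  "degree (monom (1 :: 'a :: comm_semiring_1) n + (\<Sum>j<n. monom (\<alpha> j) j)) = n"
proof (rule antisym)
  show "degree (monom (1 :: 'a) n + (\<Sum>j<n. monom (\<alpha> j) j)) \<le> n"
    by (rule degree_le) (simp add: coeff_monic_sum del: coeff_add)
  show "n \<le> degree (monom (1 :: 'a) n + (\<Sum>j<n. monom (\<alpha> j) j))"
    by (rule le_degree) (simp add: coeff_monic_sum del: coeff_add)
qed

theorem theorem2:
  shows
    "(\<forall>(m :: nat) (\<alpha> :: nat \<Rightarrow> bit) (Q :: bit poly).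
        Q = monom 1 (2 * m) + (\<Sum>j<2 * m. monom (\<alpha> j) j) \<longrightarrow> irreducible Q \<longrightarrow>
        (\<alpha> (2 * m - 1) = 1 \<longrightarrow>
          (\<forall>R \<in> {[:0, 1, 1:], [:1, 1, 1:]}.
            irreducible (Q \<circ>\<^sub>p R) \<and> degree (Q \<circ>\<^sub>p R) = 2 * (2 * m))) \<and>
        (\<alpha> (2 * m - 1) = 0 \<longrightarrow>
          (\<forall>R \<in> {[:0, 1, 1:], [:1, 1, 1:]}. \<exists>F G.
            Q \<circ>\<^sub>p R = F * G \<and> irreducible F \<and> irreducible G \<and>
            degree F = 2 * m \<and> degree G = 2 * m \<and>
            rel_trace (2 * m) F = rel_trace (2 * m) G)))
     \<and>
     (\<forall>(m :: nat) (\<alpha> :: nat \<Rightarrow> bit) (Q :: bit poly).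
        Q = monom 1 (2 * m + 1) + (\<Sum>j\<le>2 * m. monom (\<alpha> j) j) \<longrightarrow> irreducible Q \<longrightarrow>
        (irreducible (Q \<circ>\<^sub>p [:1 + \<alpha> (2 * m), 1, 1:]) \<and>
         degree (Q \<circ>\<^sub>p [:1 + \<alpha> (2 * m), 1, 1:]) = 2 * (2 * m + 1)) \<and>
        (\<exists>F G.
          Q \<circ>\<^sub>p [:\<alpha> (2 * m), 1, 1:] = F * G \<and> irreducible F \<and> irreducible G \<and>
          degree F = 2 * m + 1 \<and> degree G = 2 * m + 1 \<and>
          rel_trace (2 * m + 1) F \<noteq> rel_trace (2 * m + 1) G))"
proof (intro conjI allI impI ballI)
  fix m :: nat and \<alpha> :: "nat \<Rightarrow> bit" and Q R :: "bit poly"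
  assume Q: "Q = monom 1 (2 * m) + (\<Sum>j<2 * m. monom (\<alpha> j) j)" and irr: "irreducible Q"
    and R: "R \<in> {[:0, 1, 1:], [:1, 1, 1:]}"
  then obtain c where c: "R = [:c, 1, 1:]" by auto
  have deg: "degree Q = 2 * m"
    using Q degree_monic_sum by blast
  \<comment> \<open>Positivity keeps the index \<open>2 * m - 1\<close> from truncating to
    0.\<close>
  hence m: "m > 0" using bit_irreducible_degree_pos[OF irr] by simp
  have "coeff Q (2 * m - 1) = \<alpha> (2 * m - 1)"
    unfolding Q coeff_monic_sum using m by simp
  \<comment> \<open>The degree is even, so the term in \<open>c\<close> vanishes and both choices of
    \<open>R\<close> are handled at once.\<close>
  hence t: "coeff Q (degree Q - 1) + of_nat (degree Q) * c = \<alpha> (2 * m - 1)"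
    by (simp add: deg)
  show "degree (Q \<circ>\<^sub>p R) = 2 * (2 * m)" by (simp add: c deg degree_pcompose)
  show "irreducible (Q \<circ>\<^sub>p R)" if "\<alpha> (2 * m - 1) = 1"
    using artin_schreier_compose_irreducible[OF irr] t that c by simp
  show "\<exists>F G. Q \<circ>\<^sub>p R = F * G \<and> irreducible F \<and> irreducible G \<and>
            degree F = 2 * m \<and> degree G = 2 * m \<and>
            rel_trace (2 * m) F = rel_trace (2 * m) G" if \<alpha>: "\<alpha> (2 * m - 1) = 0"
  proof -
    obtain F G where FG: "Q \<circ>\<^sub>p R = F * G" "irreducible F" "irreducible G"
      "degree F = 2 * m" "degree G = 2 * m"
      "rel_trace (2 * m) F + rel_trace (2 * m) G = of_nat (2 * m)"
      using artin_schreier_compose_splits[OF irr, of c] t \<alpha> unfolding deg c by metis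
    \<comment> \<open>The traces sum to \<open>2 * m\<close>, which is 0 in
      \<open>bit\<close>.\<close>
    have "rel_trace (2 * m) F = rel_trace (2 * m) G"
      using FG(6) by (cases "rel_trace (2 * m) F"; cases "rel_trace (2 * m) G") simp_all
    thus ?thesis using FG by blast
  qed
next
  fix m :: nat and \<alpha> :: "nat \<Rightarrow> bit" and Q :: "bit poly"
  assume Q: "Q = monom 1 (2 * m + 1) + (\<Sum>j\<le>2 * m. monom (\<alpha> j) j)" and irr: "irreducible Q"
  have Q': "Q = monom 1 (2 * m + 1) + (\<Sum>j<2 * m + 1. monom (\<alpha> j) j)"
    unfolding Q by (simp add: lessThan_Suc_atMost)
  have deg: "degree Q = 2 * m + 1" using Q' degree_monic_sum by blast
  have top: "coeff Q (degree Q - 1) = \<alpha> (2 * m)"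
    unfolding deg unfolding Q' coeff_monic_sum by simp
  \<comment> \<open>For odd degree the criterion becomes \<open>\<alpha> (2 * m) + c\<close>, which
    is 1 for \<open>c = 1 + \<alpha> (2 * m)\<close> and 0 for
    \<open>c = \<alpha> (2 * m)\<close>.\<close>
  have odd: "of_nat (degree Q) = (1 :: bit)" by (simp add: deg)
  show "degree (Q \<circ>\<^sub>p [:1 + \<alpha> (2 * m), 1, 1:]) = 2 * (2 * m + 1)" by (simp add: deg degree_pcompose)
  show "irreducible (Q \<circ>\<^sub>p [:1 + \<alpha> (2 * m), 1, 1:])"
    by (rule artin_schreier_compose_irreducible[OF irr], unfold top odd)
       (cases "\<alpha> (2 * m)"; simp)
  have "coeff Q (degree Q - 1) + of_nat (degree Q) * \<alpha> (2 * m) = 0"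
    unfolding top odd by simp
  then obtain F G where FG: "Q \<circ>\<^sub>p [:\<alpha> (2 * m), 1, 1:] = F * G" "irreducible F" "irreducible G"
    "degree F = 2 * m + 1" "degree G = 2 * m + 1"
    "rel_trace (2 * m + 1) F + rel_trace (2 * m + 1) G = of_nat (degree Q)"
    using artin_schreier_compose_splits[OF irr, of "\<alpha> (2 * m)"] unfolding deg by metis
  \<comment> \<open>The traces now sum to 1, whereas equal ones would sum to 0.\<close>
  have "rel_trace (2 * m + 1) F \<noteq> rel_trace (2 * m + 1) G"
    using FG(6) unfolding odd by auto
  thus "\<exists>F G. Q \<circ>\<^sub>p [:\<alpha> (2 * m), 1, 1:] = F * G \<and> irreducible F \<and> irreducible G \<and>
          degree F = 2 * m + 1 \<and> degree G = 2 * m + 1 \<and>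
          rel_trace (2 * m + 1) F \<noteq> rel_trace (2 * m + 1) G"
    using FG by blast
qed

end
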